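(* Let $0<\beta<1$, $x_0>0$, $0\le\mu<1$ and $p>1/\beta$. Assume: (1) $\phi$ is a nonnegative, continuous and nondecreasing function on $[0,+\infty)$, and there exists a nonnegative constant $M$ such that $|\phi(t)|\le M t^{\mu}$ for all $t\in[0,+\infty)$; (2) $t^{\beta}l(t)$ is a nonnegative, continuous and nonincreasing function on $(0,+\infty)$, and $t^{(1-\mu)(1-\beta)}l(t)\in L^{p}[0,1]$; (3) $t^{\beta}k(t)$ is a nonnegative, continuous and nonincreasing function on $(0,+\infty)$, and $t^{1-\beta}k(t)\in L^{p}[0,1]$. Then the Riemann-Liouville fractional differential equation $$D_{0^{+}}^{\beta}x(t)=l(t)\phi(x(t))+k(t),\quad t\in(0,+\infty),\qquad \lim_{t\to0^{+}}t^{1-\beta}x(t)=x_{0},$$ has at least one decreasing solution $x\in C^{+}_{1-\beta}(0,+\infty)$.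
   Context: The Riemann-Liouville fractional integral of order $\alpha\in(0,1)$ is $I_{0^{+}}^{\alpha}\rho(t)=\frac{1}{\Gamma(\alpha)}\int_{0}^{t}(t-s)^{\alpha-1}\rho(s)\,ds$. The Riemann-Liouville fractional derivative of order $\beta\in(0,1)$ is $D_{0^{+}}^{\beta}\rho(t)=\frac{d}{dt}I_{0^{+}}^{1-\beta}\rho(t)=\frac{1}{\Gamma(1-\beta)}\frac{d}{dt}\int_{0}^{t}(t-s)^{-\beta}\rho(s)\,ds$, where $I_{0^{+}}^{1-\beta}\rho$ is an absolutely continuous function. For $\alpha\in(0,1)$, $C^{+}_{\alpha}(0,+\infty)$ is the set of nonnegative continuous functions $x$ on $(0,+\infty)$ such that $t^{\alpha}x(t)$ is (extends to) a nonnegative continuous function on $[0,+\infty)$. A solution is a function satisfying both the differential equation for all $t\in(0,+\infty)$ and the initial condition. "Decreasing" means strictly decreasing, as distinguished from "nonincreasing". When $\mu=0$, $t^{\mu}=1$ for all $t\ge0$, including $t=0$. *)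

theory Defs
  imports "HOL-Analysis.Analysis"
begin

(* In HOL 0 powr 0 = 0; here the exponent 0 gives 1 also at the base 0. *)
definition rpower :: "real \<Rightarrow> real \<Rightarrow> real" where
  "rpower t a = (if a = 0 then 1 else t powr a)"

definition in_Lp :: "real \<Rightarrow> real set \<Rightarrow> (real \<Rightarrow> real) \<Rightarrow> bool" where
  "in_Lp p A f \<longleftrightarrow>
     set_borel_measurable lebesgue A f \<and>
     set_integrable lebesgue A (\<lambda>t. \<bar>f t\<bar> powr p)"

(* A pair (u, v) in I stands for the interval from u to v. *)
definition abs_continuous_on :: "real set \<Rightarrow> (real \<Rightarrow> real) \<Rightarrow> bool" where
  "abs_continuous_on S f \<longleftrightarrow>
     (\<forall>\<epsilon>>0. \<exists>\<delta>>0. \<forall>I :: (real \<times> real) set.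
        finite I \<and> (\<forall>(u, v)\<in>I. u \<le> v \<and> {u..v} \<subseteq> S) \<and>
        pairwise (\<lambda>(u, v) (u', v'). {u<..<v} \<inter> {u'<..<v'} = {}) I \<and>
        (\<Sum>(u, v)\<in>I. v - u) < \<delta>
        \<longrightarrow> (\<Sum>(u, v)\<in>I. \<bar>f v - f u\<bar>) < \<epsilon>)"

definition RL_integral :: "real \<Rightarrow> (real \<Rightarrow> real) \<Rightarrow> real \<Rightarrow> real" where
  "RL_integral \<alpha> \<rho> t =
     1 / Gamma \<alpha> * set_lebesgue_integral lebesgue {0..t} (\<lambda>s. (t - s) powr (\<alpha> - 1) * \<rho> s)"

(* The integrability conjunct is needed because a Lebesgue integral that does not exist
   has the value 0 in HOL. *)
definition RL_integrable :: "real \<Rightarrow> (real \<Rightarrow> real) \<Rightarrow> bool" where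
  "RL_integrable \<alpha> \<rho> \<longleftrightarrow>
     (\<forall>t>0. set_integrable lebesgue {0..t} (\<lambda>s. (t - s) powr (\<alpha> - 1) * \<rho> s))"

(* RL_integral (1 - \<beta>) \<rho> has the value 0 at t = 0, which need not be its limit there: for
   \<rho> t = t powr (\<beta> - 1) it is the constant Gamma \<beta> on t > 0.  Absolute continuity is therefore
   required on every {0<..T}; equivalently, the function on t > 0 extends to one that is
   absolutely continuous on every [0, T]. *)
definition has_RL_derivative :: "real \<Rightarrow> (real \<Rightarrow> real) \<Rightarrow> real \<Rightarrow> real \<Rightarrow> bool" where
  "has_RL_derivative \<beta> \<rho> d t \<longleftrightarrow>
     RL_integrable (1 - \<beta>) \<rho> \<and>
     (\<forall>T>0. abs_continuous_on {0<..T} (RL_integral (1 - \<beta>) \<rho>)) \<and>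
     (RL_integral (1 - \<beta>) \<rho> has_real_derivative d) (at t)"

definition C_plus :: "real \<Rightarrow> (real \<Rightarrow> real) set" where
  "C_plus \<alpha> = {x. continuous_on {0<..} x \<and> (\<forall>t>0. 0 \<le> x t) \<and>
     (\<exists>y. continuous_on {0..} y \<and> (\<forall>t\<ge>0. 0 \<le> y t) \<and> (\<forall>t>0. y t = t powr \<alpha> * x t))}"

definition RL_solution ::
  "real \<Rightarrow> real \<Rightarrow> (real \<Rightarrow> real) \<Rightarrow> (real \<Rightarrow> real) \<Rightarrow> (real \<Rightarrow> real) \<Rightarrow> (real \<Rightarrow> real) \<Rightarrow> bool" where
  "RL_solution \<beta> x0 l \<phi> k x \<longleftrightarrow>
     (\<forall>t>0. has_RL_derivative \<beta> x (l t * \<phi> (x t) + k t) t) \<and>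
     ((\<lambda>t. t powr (1 - \<beta>) * x t) \<longlongrightarrow> x0) (at_right 0)"

end

theory Submission
  imports Defs
begin

text \<open>
  The differential equation is solved by way of the integral equation
  \<open>x t = x0 * t powr (\<beta> - 1) + RL_integral \<beta> (\<lambda>s. l s * \<phi> (x s) + k s) t\<close>.
  Its right-hand side is an order preserving operator, since \<open>\<phi>\<close> is nondecreasing, so
  the argument of Knaster and Tarski yields a fixed point.

  Three observations make this work.

  \<^item> Substituting \<open>s = t * u\<close> writes \<open>Gamma \<beta> * RL_integral \<beta> \<rho> t\<close> as an average of
    \<open>g (t * u)\<close> over \<open>u\<close> in \<open>(0, 1)\<close> against a fixed positive weight, where
    \<open>g s = s powr \<beta> * \<rho> s\<close> (\<open>RL_integral_scaled\<close>). So if \<open>g\<close> is nonincreasing, then so is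
    the fractional integral (\<open>RL_antimono\<close>), and the operator maps nonincreasing functions to
    nonincreasing functions. The summand \<open>x0 * t powr (\<beta> - 1)\<close> makes the fixed point strictly
    decreasing.

  \<^item> Because \<open>t powr \<beta> * l t\<close> is nonincreasing, the \<open>L\<^sup>p\<close> condition implies a
    pointwise power bound on \<open>l\<close> in \<open>(0, 1]\<close>, and the same holds for \<open>k\<close>
    (\<open>Lp_antimono_pointwise_bound\<close>). If \<open>x s \<le> R * s powr (\<beta> - 1)\<close>, then with
    \<open>\<delta> = \<beta> - 1 / p > 0\<close> the right-hand side of the differential equation is at most a constant
    times \<open>s powr (\<delta> - 1)\<close> on \<open>(0, 1]\<close>, and every integral to be estimated is a Beta integral
    (\<open>RL_bound\<close>). The constant grows like \<open>R powr \<mu>\<close> with \<open>\<mu> < 1\<close>, so for large \<open>R\<close> the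
    bound \<open>R * t powr (\<beta> - 1)\<close> on \<open>(0, 1]\<close> is preserved by the operator
    (\<open>sublinear_supersolution\<close>). Beyond \<open>1\<close> monotonicity gives the bound \<open>R\<close>. On the
    nonincreasing functions below this barrier the operator has a fixed point
    (\<open>antimono_fixed_point\<close>).

  \<^item> A nonincreasing \<open>g\<close> has only countably many discontinuities, so dominated convergence makes
    the average above continuous in \<open>t\<close> (\<open>RL_continuous\<close>). Hence the fixed point, obtained
    as a mere supremum, is continuous because it is its own image. Tonelli's theorem and a Beta
    integral give
    \<open>RL_integral (1 - \<beta>) x t = x0 * Gamma \<beta> + \<integral>\<^sub>0\<^sup>t \<rho>\<close> for
    \<open>x t = x0 * t powr (\<beta> - 1) + RL_integral \<beta> \<rho> t\<close> (\<open>RL_integral_solution\<close>); the right-hand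
    side is absolutely continuous and, as \<open>\<rho>\<close> is continuous, has the derivative \<open>\<rho> t\<close>.
\<close>

section \<open>Beta integrals and the scaled form of the fractional integral\<close>

text \<open>Up to the factor \<open>Gamma \<beta>\<close>, the density by which the fractional integral averages
  \<open>g (t * u)\<close>, where \<open>g s = s powr \<beta> * \<rho> s\<close>.\<close>

definition rl_weight :: "real \<Rightarrow> real \<Rightarrow> real" where
  "rl_weight \<beta> u = indicator {0<..<1} u * ((1 - u) powr (\<beta> - 1) * u powr (-\<beta>))"

lemma rl_weight_nonneg: "0 \<le> rl_weight \<beta> u"
  by (auto simp: rl_weight_def)

lemma rl_weight_measurable [measurable]: "rl_weight \<beta> \<in> borel_measurable borel"
  unfolding rl_weight_def by measurable

lemma nn_integral_Beta:
  fixes a b :: real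
  assumes "0 < a" "0 < b"
  shows "(\<integral>\<^sup>+u. ennreal (indicator {0<..<1} u * (u powr (a - 1) * (1 - u) powr (b - 1))) \<partial>lborel)
    = ennreal (Beta a b)"
proof -
  have "((\<lambda>u. u powr (a - 1) * (1 - u) powr (b - 1)) has_integral Beta a b) {0<..<1}"
    using has_integral_Beta_real[OF assms] by (simp add: has_integral_Icc_iff_Ioo)
  from nn_integral_has_integral_lebesgue[OF _ this] show ?thesis by simp
qed

text \<open>The affine image of the Beta integral; it evaluates the convolution of two power kernels.\<close>

lemma nn_integral_Beta_interval:
  fixes a b r t :: real
  assumes "0 < a" "0 < b" "r < t"
  shows "(\<integral>\<^sup>+s. ennreal (indicator {r<..<t} s * ((s - r) powr (a - 1) * (t - s) powr (b - 1))) \<partial>lborel)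
    = ennreal (Beta a b * (t - r) powr (a + b - 1))"
proof -
  define d where "d = t - r"
  have d: "0 < d" "t = r + d" using assms by (auto simp: d_def)
  have eq: "d * (indicator {r<..<t} (r + d * u) * ((r + d * u - r) powr (a - 1) * (t - (r + d * u)) powr (b - 1)))
      = d powr (a + b - 1) * (indicator {0<..<1} u * (u powr (a - 1) * (1 - u) powr (b - 1)))" for u
  proof (cases "0 < u \<and> u < 1")
    case True
    have "t - (r + d * u) = d * (1 - u)" using d by (simp add: algebra_simps)
    moreover have "d * (d powr (a - 1) * d powr (b - 1)) = d powr (a + b - 1)"
    proof -
      have "d powr (a + b - 1) = d powr (1 + ((a - 1) + (b - 1)))" by (simp add: algebra_simps)
      also have "\<dots> = d powr 1 * (d powr (a - 1) * d powr (b - 1))" by (simp only: powr_add)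
      finally show ?thesis using d by simp
    qed
    moreover have "r < r + d * u" "r + d * u < t" using True d by (auto simp: mult_less_cancel_left1)
    ultimately show ?thesis using True d
      by (simp add: powr_mult)
  next
    case False
    then have "\<not> (r < r + d * u \<and> r + d * u < t)" using d by (auto simp: mult_less_cancel_left1 zero_less_mult_iff)
    then show ?thesis using False by auto
  qed
  have "(\<integral>\<^sup>+s. ennreal (indicator {r<..<t} s * ((s - r) powr (a - 1) * (t - s) powr (b - 1))) \<partial>lborel)
     = ennreal \<bar>d\<bar> * (\<integral>\<^sup>+u. ennreal (indicator {r<..<t} (r + d * u) * ((r + d * u - r) powr (a - 1) * (t - (r + d * u)) powr (b - 1))) \<partial>lborel)"
    using d by (intro nn_integral_real_affine) auto
  also have "\<dots> = (\<integral>\<^sup>+u. ennreal (d * (indicator {r<..<t} (r + d * u) * ((r + d * u - r) powr (a - 1) * (t - (r + d * u)) powr (b - 1)))) \<partial>lborel)"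
    using d by (subst nn_integral_cmult[symmetric]) (auto simp: ennreal_mult' intro!: nn_integral_cong)
  also have "\<dots> = (\<integral>\<^sup>+u. ennreal (d powr (a + b - 1)) * ennreal (indicator {0<..<1} u * (u powr (a - 1) * (1 - u) powr (b - 1))) \<partial>lborel)"
    by (simp only: eq) (simp add: ennreal_mult')
  also have "\<dots> = ennreal (d powr (a + b - 1)) * ennreal (Beta a b)"
    by (subst nn_integral_cmult) (simp_all only: nn_integral_Beta[OF assms(1,2)], measurable)
  finally show ?thesis by (simp only: d_def mult.commute[of "Beta a b"] ennreal_mult'[OF powr_ge_zero])
qed

lemma measurable_of_antimono_on_pos:
  fixes g :: "real \<Rightarrow> real"
  assumes "antimono_on {0<..} g"
  shows "(\<lambda>s. indicator {0<..} s * g s) \<in> borel_measurable borel"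
proof -
  have "mono_on {0<..} (\<lambda>s. - g s)"
    using assms by (auto simp: monotone_on_def)
  from borel_measurable_mono_on_fnc[OF this]
  have "(\<lambda>s. - (- g s)) \<in> borel_measurable (restrict_space borel {0<..})" by measurable
  then show ?thesis by (simp add: borel_measurable_restrict_space_iff)
qed

text \<open>For a Borel function that vanishes at 0 the endpoints of \<open>[0, t]\<close> contribute nothing even
  pointwise, because \<open>0 powr a = 0\<close> at the endpoint \<open>s = t\<close>.\<close>

lemma
  fixes \<rho> :: "real \<Rightarrow> real"
  assumes [measurable]: "\<rho> \<in> borel_measurable borel" and \<rho>0: "\<rho> 0 = 0"
  shows RL_integral_lborel:
      "RL_integral \<alpha> \<rho> t = 1 / Gamma \<alpha> * (\<integral>s. indicator {0<..<t} s * ((t - s) powr (\<alpha> - 1) * \<rho> s) \<partial>lborel)"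
    and RL_integrand_integrable_lborel:
      "set_integrable lebesgue {0..t} (\<lambda>s. (t - s) powr (\<alpha> - 1) * \<rho> s) \<longleftrightarrow>
       integrable lborel (\<lambda>s. indicator {0<..<t} s * ((t - s) powr (\<alpha> - 1) * \<rho> s))"
proof -
  have eq: "indicator {0..t} s *\<^sub>R ((t - s) powr (\<alpha> - 1) * \<rho> s) = indicator {0<..<t} s * ((t - s) powr (\<alpha> - 1) * \<rho> s)" for s
    using \<rho>0 by (cases "s = 0"; cases "s = t") (auto simp: indicator_def)
  have "(\<lambda>s. indicator {0<..<t} s * ((t - s) powr (\<alpha> - 1) * \<rho> s)) \<in> borel_measurable lborel"
    by measurable
  then show "RL_integral \<alpha> \<rho> t = 1 / Gamma \<alpha> * (\<integral>s. indicator {0<..<t} s * ((t - s) powr (\<alpha> - 1) * \<rho> s) \<partial>lborel)"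
    "set_integrable lebesgue {0..t} (\<lambda>s. (t - s) powr (\<alpha> - 1) * \<rho> s) \<longleftrightarrow>
       integrable lborel (\<lambda>s. indicator {0<..<t} s * ((t - s) powr (\<alpha> - 1) * \<rho> s))"
    unfolding RL_integral_def set_lebesgue_integral_def set_integrable_def eq
    by (simp_all add: integral_completion integrable_completion)
qed

text \<open>The substitution \<open>s = t * u\<close>. The factor \<open>s powr \<beta>\<close> is moved to the function because
  the product is what is assumed to be monotone; all dependence on \<open>t\<close> is then in the argument
  of that monotone function.\<close>

lemma
  fixes \<rho> :: "real \<Rightarrow> real"
  assumes [measurable]: "\<rho> \<in> borel_measurable borel" and \<rho>0: "\<rho> 0 = 0" and t: "0 < t"
  shows RL_integral_scaled:
      "RL_integral \<beta> \<rho> t = 1 / Gamma \<beta> * (\<integral>u. rl_weight \<beta> u * ((t * u) powr \<beta> * \<rho> (t * u)) \<partial>lborel)"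
    and RL_integrand_integrable_scaled:
      "set_integrable lebesgue {0..t} (\<lambda>s. (t - s) powr (\<beta> - 1) * \<rho> s) \<longleftrightarrow>
       integrable lborel (\<lambda>u. rl_weight \<beta> u * ((t * u) powr \<beta> * \<rho> (t * u)))"
proof -
  let ?f = "\<lambda>s. indicator {0<..<t} s * ((t - s) powr (\<beta> - 1) * \<rho> s)"
  have eq: "\<bar>t\<bar> *\<^sub>R ?f (0 + t * u) = rl_weight \<beta> u * ((t * u) powr \<beta> * \<rho> (t * u))" for u
  proof (cases "0 < u \<and> u < 1")
    case True
    have "t - t * u = t * (1 - u)" by (simp add: algebra_simps)
    moreover have "t powr \<beta> = t * t powr (\<beta> - 1)"
      using t by (simp add: powr_diff)
    moreover have "u powr (-\<beta>) * u powr \<beta> = 1" using True by (simp flip: powr_add)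
    moreover have "t * u < t" using True t by simp
    ultimately show ?thesis using True t
      by (simp add: rl_weight_def powr_mult)
  next
    case False
    then have "\<not> (0 < t * u \<and> t * u < t)" using t by (auto simp: zero_less_mult_iff)
    then show ?thesis using False by (auto simp: rl_weight_def)
  qed
  have "integrable lborel ?f \<longleftrightarrow> integrable lborel (\<lambda>u. \<bar>t\<bar> *\<^sub>R ?f (0 + t * u))"
    using t lborel_integrable_real_affine_iff[of t ?f 0] by simp
  then show "set_integrable lebesgue {0..t} (\<lambda>s. (t - s) powr (\<beta> - 1) * \<rho> s) \<longleftrightarrow>
       integrable lborel (\<lambda>u. rl_weight \<beta> u * ((t * u) powr \<beta> * \<rho> (t * u)))"
    unfolding eq by (simp add: RL_integrand_integrable_lborel \<rho>0)
  have "integral\<^sup>L lborel ?f = (\<integral>u. \<bar>t\<bar> *\<^sub>R ?f (0 + t * u) \<partial>lborel)"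
    using t lborel_integral_real_affine[of t ?f 0] by simp
  then show "RL_integral \<beta> \<rho> t = 1 / Gamma \<beta> * (\<integral>u. rl_weight \<beta> u * ((t * u) powr \<beta> * \<rho> (t * u)) \<partial>lborel)"
    unfolding eq by (simp add: RL_integral_lborel \<rho>0)
qed

section \<open>Fractional integrals of decreasing functions\<close>

text \<open>The shape that \<open>\<rho> s = l s * \<phi> (x s) + k s\<close> has when \<open>x\<close> is nonincreasing and bounded by a
  multiple of \<open>s powr (\<beta> - 1)\<close> near 0. The extension by 0 to \<open>s \<le> 0\<close> makes \<open>\<rho>\<close> a Borel
  function on the whole line.\<close>

locale decreasing_forcing =
  fixes \<beta> \<delta> H :: real and \<rho> :: "real \<Rightarrow> real"
  assumes \<beta>: "0 < \<beta>" "\<beta> < 1" and \<delta>: "0 < \<delta>"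
    and zero: "\<And>s. s \<le> 0 \<Longrightarrow> \<rho> s = 0"
    and nonneg: "\<And>s. 0 \<le> \<rho> s"
    and antimono: "antimono_on {0<..} (\<lambda>s. s powr \<beta> * \<rho> s)"
    and bound: "\<And>s. 0 < s \<Longrightarrow> s \<le> 1 \<Longrightarrow> \<rho> s \<le> H * s powr (\<delta> - 1)"
begin

lemma measurable [measurable]: "\<rho> \<in> borel_measurable borel"
proof -
  have "(\<lambda>s. indicator {0<..} s * (s powr \<beta> * \<rho> s)) \<in> borel_measurable borel"
    by (rule measurable_of_antimono_on_pos[OF antimono])
  then have "(\<lambda>s. s powr (-\<beta>) * (indicator {0<..} s * (s powr \<beta> * \<rho> s))) \<in> borel_measurable borel"
    by measurable
  also have "(\<lambda>s. s powr (-\<beta>) * (indicator {0<..} s * (s powr \<beta> * \<rho> s))) = \<rho>"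
  proof
    fix s show "s powr (-\<beta>) * (indicator {0<..} s * (s powr \<beta> * \<rho> s)) = \<rho> s"
      using zero[of s] by (cases "0 < s") (auto simp: powr_minus field_simps)
  qed
  finally show ?thesis .
qed

lemma weighted_antimono:
  assumes "0 < t" "t \<le> t'"
  shows "rl_weight \<beta> u * ((t' * u) powr \<beta> * \<rho> (t' * u)) \<le> rl_weight \<beta> u * ((t * u) powr \<beta> * \<rho> (t * u))"
proof (cases "0 < u")
  case True
  then show ?thesis using assms antimono
    by (intro mult_left_mono rl_weight_nonneg) (auto simp: monotone_on_def)
qed (auto simp: rl_weight_def)

text \<open>On \<open>(0, 1]\<close> the power bound on \<open>\<rho>\<close> turns the integrand into that of
  \<open>Beta \<delta> \<beta>\<close>.\<close>

lemma
  assumes t: "0 < t" "t \<le> 1"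
  shows integrable_unit: "integrable lborel (\<lambda>u. rl_weight \<beta> u * ((t * u) powr \<beta> * \<rho> (t * u)))"
    and integral_unit: "(\<integral>u. rl_weight \<beta> u * ((t * u) powr \<beta> * \<rho> (t * u)) \<partial>lborel)
      \<le> H * Beta \<delta> \<beta> * t powr (\<beta> + \<delta> - 1)"
proof -
  let ?b = "\<lambda>u::real. indicator {0<..<1} u * (u powr (\<delta> - 1) * (1 - u) powr (\<beta> - 1)) :: real"
  have B0: "0 \<le> Beta \<delta> \<beta>"
    using \<beta> \<delta> by (simp add: Beta_def Gamma_real_nonneg)
  have B: "integrable lborel ?b"
    by (rule integrableI_nn_integral_finite[OF _ _ nn_integral_Beta]) (use \<beta> \<delta> in auto)
  have IB: "integral\<^sup>L lborel ?b = Beta \<delta> \<beta>"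
    by (subst integral_eq_nn_integral) (use \<beta> \<delta> B0 nn_integral_Beta[of \<delta> \<beta>] in auto)
  have le: "rl_weight \<beta> u * ((t * u) powr \<beta> * \<rho> (t * u)) \<le> H * t powr (\<beta> + \<delta> - 1) * ?b u" for u
  proof (cases "0 < u \<and> u < 1")
    case True
    then have tu: "0 < t * u" "t * u \<le> 1" using t by (auto simp: mult_le_one)
    have "(t * u) powr \<beta> * \<rho> (t * u) \<le> (t * u) powr \<beta> * (H * (t * u) powr (\<delta> - 1))"
      by (intro mult_left_mono bound tu) auto
    also have "\<dots> = H * (t * u) powr (\<beta> + (\<delta> - 1))" by (simp add: powr_add)
    finally have "rl_weight \<beta> u * ((t * u) powr \<beta> * \<rho> (t * u)) \<le> rl_weight \<beta> u * (H * (t * u) powr (\<beta> + (\<delta> - 1)))"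
      by (rule mult_left_mono[OF _ rl_weight_nonneg])
    also have "\<dots> = H * t powr (\<beta> + (\<delta> - 1)) * ((u powr (-\<beta>) * u powr (\<beta> + (\<delta> - 1))) * (1 - u) powr (\<beta> - 1))"
      using True t by (simp add: rl_weight_def powr_mult)
    also have "u powr (-\<beta>) * u powr (\<beta> + (\<delta> - 1)) = u powr (\<delta> - 1)"
      by (simp flip: powr_add)
    finally show ?thesis using True by (simp add: algebra_simps)
  qed (auto simp: rl_weight_def)
  show *: "integrable lborel (\<lambda>u. rl_weight \<beta> u * ((t * u) powr \<beta> * \<rho> (t * u)))"
  proof (rule Bochner_Integration.integrable_bound)
    show "integrable lborel (\<lambda>u. H * t powr (\<beta> + \<delta> - 1) * ?b u)" using B by simp
    show "AE u in lborel. norm (rl_weight \<beta> u * ((t * u) powr \<beta> * \<rho> (t * u))) \<le> norm (H * t powr (\<beta> + \<delta> - 1) * ?b u)"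
    proof (rule AE_I2)
      fix u
      have "0 \<le> rl_weight \<beta> u * ((t * u) powr \<beta> * \<rho> (t * u))"
        by (intro mult_nonneg_nonneg rl_weight_nonneg nonneg) auto
      with le[of u] show "norm (rl_weight \<beta> u * ((t * u) powr \<beta> * \<rho> (t * u))) \<le> norm (H * t powr (\<beta> + \<delta> - 1) * ?b u)"
        unfolding real_norm_def by linarith
    qed
  qed measurable
  have "(\<integral>u. rl_weight \<beta> u * ((t * u) powr \<beta> * \<rho> (t * u)) \<partial>lborel) \<le> (\<integral>u. H * t powr (\<beta> + \<delta> - 1) * ?b u \<partial>lborel)"
    by (intro integral_mono * le) (use B in simp)
  also have "\<dots> = H * Beta \<delta> \<beta> * t powr (\<beta> + \<delta> - 1)" by (subst integral_mult_right_zero) (simp only: IB mult_ac)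
  finally show "(\<integral>u. rl_weight \<beta> u * ((t * u) powr \<beta> * \<rho> (t * u)) \<partial>lborel)
      \<le> H * Beta \<delta> \<beta> * t powr (\<beta> + \<delta> - 1)" .
qed

text \<open>By monotonicity the integrand for \<open>t > 1\<close> is dominated by the one for \<open>t = 1\<close>.\<close>

lemma integrable_scaled:
  assumes "0 < t"
  shows "integrable lborel (\<lambda>u. rl_weight \<beta> u * ((t * u) powr \<beta> * \<rho> (t * u)))"
proof (rule Bochner_Integration.integrable_bound)
  show "integrable lborel (\<lambda>u. rl_weight \<beta> u * ((min t 1 * u) powr \<beta> * \<rho> (min t 1 * u)))"
    using assms by (intro integrable_unit) auto
  show "AE u in lborel. norm (rl_weight \<beta> u * ((t * u) powr \<beta> * \<rho> (t * u)))
      \<le> norm (rl_weight \<beta> u * ((min t 1 * u) powr \<beta> * \<rho> (min t 1 * u)))"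
    using weighted_antimono[of "min t 1" t] assms
    by (intro AE_I2) (simp add: rl_weight_nonneg nonneg)
qed measurable

lemma RL_nonneg: "0 \<le> RL_integral \<beta> \<rho> t"
proof -
  have "0 \<le> Gamma \<beta>" using \<beta> by (simp add: Gamma_real_nonneg)
  moreover have "0 \<le> (\<integral>s. indicator {0<..<t} s * ((t - s) powr (\<beta> - 1) * \<rho> s) \<partial>lborel)"
    by (intro integral_nonneg_AE AE_I2) (simp add: nonneg)
  ultimately show ?thesis by (simp add: RL_integral_lborel zero)
qed

lemma RL_antimono: "antimono_on {0<..} (RL_integral \<beta> \<rho>)"
proof (rule monotone_onI)
  fix t t' :: real assume t: "t \<in> {0<..}" "t' \<in> {0<..}" "t \<le> t'"
  then have "(\<integral>u. rl_weight \<beta> u * ((t' * u) powr \<beta> * \<rho> (t' * u)) \<partial>lborel)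
      \<le> (\<integral>u. rl_weight \<beta> u * ((t * u) powr \<beta> * \<rho> (t * u)) \<partial>lborel)"
    by (intro integral_mono integrable_scaled weighted_antimono) auto
  moreover have "0 < Gamma \<beta>" using \<beta> by (simp add: Gamma_real_pos)
  ultimately show "RL_integral \<beta> \<rho> t' \<le> RL_integral \<beta> \<rho> t"
    using t by (simp add: RL_integral_scaled zero divide_right_mono)
qed

lemma RL_bound:
  assumes "0 < t" "t \<le> 1"
  shows "RL_integral \<beta> \<rho> t \<le> H * Beta \<delta> \<beta> / Gamma \<beta> * t powr (\<beta> + \<delta> - 1)"
proof -
  have "0 < Gamma \<beta>" using \<beta> by (simp add: Gamma_real_pos)
  then show ?thesis using integral_unit[OF assms] assms
    by (simp add: RL_integral_scaled zero divide_right_mono)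
qed

text \<open>Although \<open>\<rho>\<close> may be discontinuous, \<open>g s = s powr \<beta> * \<rho> s\<close> is monotone, so for each
  \<open>t\<close> the function \<open>g\<close> is continuous at \<open>t * u\<close> for all but countably many \<open>u\<close>. The
  integrand for \<open>t / 2\<close> dominates those for the parameters near \<open>t\<close>.\<close>

lemma RL_continuous: "continuous_on {0<..} (RL_integral \<beta> \<rho>)"
proof -
  let ?g = "\<lambda>s. s powr \<beta> * \<rho> s"
  have "mono_on {0<..} (\<lambda>s. - ?g s)" using antimono by (auto simp: monotone_on_def)
  from mono_on_ctble_discont_open[OF _ this]
  have C: "countable {s\<in>{0<..}. \<not> isCont ?g s}"
    by (simp add: isCont_def tendsto_minus_cancel_left del: minus_mult_right)
  have cont: "isCont (\<lambda>t. \<integral>u. rl_weight \<beta> u * ?g (t * u) \<partial>lborel) t" if t: "0 < t" for t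
    unfolding continuous_at_sequentially o_def
  proof (intro allI impI)
    fix X :: "nat \<Rightarrow> real" assume X: "X \<longlonglongrightarrow> t"
    have ev: "eventually (\<lambda>n. t / 2 < X n) sequentially"
      using t order_tendstoD(1)[OF X, of "t / 2"] by simp
    then obtain N where N: "\<And>n. N \<le> n \<Longrightarrow> t / 2 < X n" by (auto simp: eventually_sequentially)
    have "(\<lambda>n. \<integral>u. rl_weight \<beta> u * ?g (X (n + N) * u) \<partial>lborel) \<longlonglongrightarrow> (\<integral>u. rl_weight \<beta> u * ?g (t * u) \<partial>lborel)"
    proof (rule integral_dominated_convergence)
      show "integrable lborel (\<lambda>u. rl_weight \<beta> u * ?g (t / 2 * u))"
        using t by (intro integrable_scaled) auto
      show "AE u in lborel. norm (rl_weight \<beta> u * ?g (X (n + N) * u)) \<le> rl_weight \<beta> u * ?g (t / 2 * u)" for n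
        using weighted_antimono[of "t / 2" "X (n + N)"] N[of "n + N"] t
        by (intro AE_I2) (simp add: rl_weight_nonneg nonneg)
      have "countable ((\<lambda>s. s / t) ` {s\<in>{0<..}. \<not> isCont ?g s})" using C by (rule countable_image)
      from AE_not_in[OF countable_imp_null_set_lborel[OF this]]
      show "AE u in lborel. (\<lambda>n. rl_weight \<beta> u * ?g (X (n + N) * u)) \<longlonglongrightarrow> rl_weight \<beta> u * ?g (t * u)"
      proof eventually_elim
        case (elim u)
        show ?case
        proof (cases "0 < u")
          case True
          have "isCont ?g (t * u)"
          proof (rule ccontr)
            assume "\<not> isCont ?g (t * u)"
            then have "(t * u) / t \<in> (\<lambda>s. s / t) ` {s\<in>{0<..}. \<not> isCont ?g s}"
              using True t by (intro imageI) simp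
            then show False using elim t by simp
          qed
          moreover have "(\<lambda>n. X (n + N) * u) \<longlonglongrightarrow> t * u"
            by (intro tendsto_intros LIMSEQ_ignore_initial_segment X)
          ultimately have "(\<lambda>n. ?g (X (n + N) * u)) \<longlonglongrightarrow> ?g (t * u)"
            by (rule isCont_tendsto_compose)
          then show ?thesis by (rule tendsto_mult[OF tendsto_const])
        qed (simp add: rl_weight_def)
      qed
    qed measurable
    then show "(\<lambda>n. \<integral>u. rl_weight \<beta> u * ?g (X n * u) \<partial>lborel) \<longlonglongrightarrow> (\<integral>u. rl_weight \<beta> u * ?g (t * u) \<partial>lborel)"
      by (rule LIMSEQ_offset)
  qed
  have "continuous_on {0<..} (\<lambda>t. 1 / Gamma \<beta> * (\<integral>u. rl_weight \<beta> u * ?g (t * u) \<partial>lborel))"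
    by (intro continuous_intros continuous_at_imp_continuous_on ballI cont) auto
  then show ?thesis
    by (rule continuous_on_cong[THEN iffD1, rotated -1]) (auto simp: RL_integral_scaled zero)
qed

lemma integrable_RL_integrand:
  "integrable lborel (\<lambda>s. indicator {0<..<t} s * ((t - s) powr (\<beta> - 1) * \<rho> s))"
proof (cases "0 < t")
  case True
  then show ?thesis
    using integrable_scaled[OF True] RL_integrand_integrable_scaled[OF measurable zero True]
    by (simp flip: RL_integrand_integrable_lborel add: zero)
next
  case False
  then have "{0<..<t} = {}" by auto
  then show ?thesis by simp
qed

text \<open>Since \<open>\<beta> < 1\<close>, the kernel \<open>(t - s) powr (\<beta> - 1)\<close> is at least \<open>t powr (\<beta> - 1)\<close>, so
  integrability of \<open>\<rho>\<close> follows from that of the fractional integrand.\<close>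

lemma integrable_forcing: "integrable lborel (\<lambda>s. indicator {0<..<t} s * \<rho> s)"
proof (rule Bochner_Integration.integrable_bound)
  show "integrable lborel (\<lambda>s. t powr (1 - \<beta>) * (indicator {0<..<t} s * ((t - s) powr (\<beta> - 1) * \<rho> s)))"
    using integrable_RL_integrand by simp
  show "AE s in lborel. norm (indicator {0<..<t} s * \<rho> s) \<le> norm (t powr (1 - \<beta>) * (indicator {0<..<t} s * ((t - s) powr (\<beta> - 1) * \<rho> s)))"
  proof (rule AE_I2)
    fix s
    show "norm (indicator {0<..<t} s * \<rho> s) \<le> norm (t powr (1 - \<beta>) * (indicator {0<..<t} s * ((t - s) powr (\<beta> - 1) * \<rho> s)))"
    proof (cases "0 < s \<and> s < t")
      case True
      have "1 = t powr (1 - \<beta>) * t powr (\<beta> - 1)" using True by (simp flip: powr_add)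
      also have "\<dots> \<le> t powr (1 - \<beta>) * (t - s) powr (\<beta> - 1)"
        using True \<beta> by (intro mult_left_mono powr_mono2') auto
      finally have "1 * \<rho> s \<le> t powr (1 - \<beta>) * (t - s) powr (\<beta> - 1) * \<rho> s"
        using nonneg by (intro mult_right_mono)
      then show ?thesis using True nonneg by (simp add: mult_ac)
    qed auto
  qed
qed measurable

end

lemma RL_integral_mono:
  assumes "decreasing_forcing \<beta> \<delta> H \<rho>" "decreasing_forcing \<beta> \<delta>' H' \<rho>'"
    and le: "\<And>s. 0 < s \<Longrightarrow> \<rho> s \<le> \<rho>' s"
  shows "RL_integral \<beta> \<rho> t \<le> RL_integral \<beta> \<rho>' t"
proof -
  interpret d: decreasing_forcing \<beta> \<delta> H \<rho> by fact
  interpret d': decreasing_forcing \<beta> \<delta>' H' \<rho>' by fact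
  have "(\<integral>s. indicator {0<..<t} s * ((t - s) powr (\<beta> - 1) * \<rho> s) \<partial>lborel)
     \<le> (\<integral>s. indicator {0<..<t} s * ((t - s) powr (\<beta> - 1) * \<rho>' s) \<partial>lborel)"
    using le by (intro integral_mono d.integrable_RL_integrand d'.integrable_RL_integrand)
      (auto simp: indicator_def intro!: mult_left_mono)
  moreover have "0 < Gamma \<beta>" using d.\<beta> by (simp add: Gamma_real_pos)
  ultimately show ?thesis
    by (simp add: RL_integral_lborel d.zero d'.zero divide_right_mono)
qed

section \<open>Inversion of the fractional integral\<close>

lemma ennreal_linear_combination:
  assumes "0 \<le> a" "0 \<le> b" "0 \<le> P" "0 \<le> Q"
  shows "ennreal (a * P + b * Q) = ennreal a * ennreal P + ennreal b * ennreal Q"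
  using assms by (simp add: ennreal_mult')

context decreasing_forcing begin

text \<open>The solution of the linear problem with right-hand side \<open>\<rho>\<close> and initial value \<open>c\<close>.\<close>

definition solution :: "real \<Rightarrow> real \<Rightarrow> real" where
  "solution c s = (if 0 < s then c * s powr (\<beta> - 1) + RL_integral \<beta> \<rho> s else 0)"

lemma solution_measurable [measurable]: "solution c \<in> borel_measurable borel"
proof -
  have [measurable]: "(\<lambda>s. indicator {0<..} s * RL_integral \<beta> \<rho> s) \<in> borel_measurable borel"
    by (rule measurable_of_antimono_on_pos[OF RL_antimono])
  have "(\<lambda>s. indicator {0<..} s * (c * s powr (\<beta> - 1)) + indicator {0<..} s * RL_integral \<beta> \<rho> s)
      \<in> borel_measurable borel" by measurable
  also have "(\<lambda>s. indicator {0<..} s * (c * s powr (\<beta> - 1)) + indicator {0<..} s * RL_integral \<beta> \<rho> s) = solution c"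
    by (auto simp: solution_def fun_eq_iff)
  finally show ?thesis .
qed

lemma solution_nonneg: "0 \<le> c \<Longrightarrow> 0 \<le> solution c s"
  by (simp add: solution_def RL_nonneg)

definition mass :: "real \<Rightarrow> real" where
  "mass t = (\<integral>s. indicator {0<..<t} s * \<rho> s \<partial>lborel)"

lemma mass_nonneg: "0 \<le> mass t"
  unfolding mass_def by (intro integral_nonneg_AE AE_I2) (simp add: nonneg)

text \<open>Exchanging the order of integration leaves, for each \<open>r\<close>, the integral of
  \<open>(t - s) powr (-\<beta>) * (s - r) powr (\<beta> - 1)\<close> over \<open>(r, t)\<close>. Its exponents sum to
  \<open>-1\<close>, so it is a Beta value that is independent of \<open>r\<close> and \<open>t\<close>.\<close>

lemma nn_integral_iterated_kernel:
  "(\<integral>\<^sup>+s. (\<integral>\<^sup>+r. ennreal (indicator {0<..<t} s * (t - s) powr (- \<beta>) *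
        (indicator {0<..<s} r * ((s - r) powr (\<beta> - 1) * \<rho> r))) \<partial>lborel) \<partial>lborel)
    = ennreal (Beta \<beta> (1 - \<beta>) * mass t)" (is "?lhs = _")
proof -
  let ?f = "\<lambda>s r. ennreal (indicator {0<..<t} s * (t - s) powr (- \<beta>) *
        ((if 0 < r \<and> r < s then 1 else 0) * ((s - r) powr (\<beta> - 1) * \<rho> r)))"
  have B0: "0 \<le> Beta \<beta> (1 - \<beta>)" using \<beta> by (simp add: Beta_def Gamma_real_nonneg)
  have "?lhs = (\<integral>\<^sup>+s. (\<integral>\<^sup>+r. ?f s r \<partial>lborel) \<partial>lborel)"
    by (intro nn_integral_cong) (auto simp: indicator_def)
  also have "\<dots> = (\<integral>\<^sup>+r. (\<integral>\<^sup>+s. ?f s r \<partial>lborel) \<partial>lborel)"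
    by (rule lborel_pair.Fubini'[symmetric]) measurable
  also have "\<dots> = (\<integral>\<^sup>+r. ennreal (Beta \<beta> (1 - \<beta>)) * ennreal (indicator {0<..<t} r * \<rho> r) \<partial>lborel)"
  proof (rule nn_integral_cong)
    fix r
    show "(\<integral>\<^sup>+s. ?f s r \<partial>lborel) = ennreal (Beta \<beta> (1 - \<beta>)) * ennreal (indicator {0<..<t} r * \<rho> r)"
    proof (cases "0 < r \<and> r < t")
      case True
      have "(\<integral>\<^sup>+s. ?f s r \<partial>lborel) = (\<integral>\<^sup>+s. ennreal (\<rho> r) *
          ennreal (indicator {r<..<t} s * ((s - r) powr (\<beta> - 1) * (t - s) powr (1 - \<beta> - 1))) \<partial>lborel)"
        using True by (subst ennreal_mult'[OF nonneg, symmetric], intro nn_integral_cong arg_cong[of _ _ ennreal])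
          (auto simp: indicator_def)
      also have "\<dots> = ennreal (\<rho> r) * ennreal (Beta \<beta> (1 - \<beta>) * (t - r) powr (\<beta> + (1 - \<beta>) - 1))"
        using True \<beta> by (subst nn_integral_cmult) (measurable, subst nn_integral_Beta_interval, auto)
      finally show ?thesis using True by (simp add: mult.commute)
    next
      case False
      then have "?f s r = 0" for s by (auto simp: indicator_def)
      then show ?thesis using False by (auto simp: indicator_def)
    qed
  qed
  also have "\<dots> = ennreal (Beta \<beta> (1 - \<beta>)) * ennreal (mass t)"
    unfolding mass_def
    by (subst nn_integral_cmult, measurable)
      (simp add: nn_integral_eq_integral[OF integrable_forcing] nonneg)
  finally show ?thesis using B0 by (simp add: ennreal_mult')
qed

text \<open>The composition rule for fractional integrals, which inverts Abel's integral operator: both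
  summands of \<open>solution c\<close> reduce to \<open>Beta \<beta> (1 - \<beta>) = Gamma \<beta> * Gamma (1 - \<beta>)\<close>. It is
  proved for nonnegative integrals, so that integrability is a consequence.\<close>

lemma nn_integral_solution:
  assumes t: "0 < t" and c: "0 \<le> c"
  shows "(\<integral>\<^sup>+s. ennreal (indicator {0<..<t} s * ((t - s) powr (- \<beta>) * solution c s)) \<partial>lborel)
    = ennreal (Gamma (1 - \<beta>) * (c * Gamma \<beta> + mass t))"
proof -
  have G: "0 < Gamma \<beta>" "0 < Gamma (1 - \<beta>)" using \<beta> by (simp_all add: Gamma_real_pos)
  let ?K = "\<lambda>s r. indicator {0<..<s} r * ((s - r) powr (\<beta> - 1) * \<rho> r)"
  let ?w = "\<lambda>s. indicator {0<..<t} s * (t - s) powr (- \<beta>)"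
  let ?p = "\<lambda>s. ennreal (indicator {0<..<t} s * ((s - 0) powr (\<beta> - 1) * (t - s) powr (1 - \<beta> - 1)))"
  let ?q = "\<lambda>s. \<integral>\<^sup>+r. ennreal (?w s * ?K s r) \<partial>lborel"
  have q: "?q s = ennreal (?w s * (Gamma \<beta> * RL_integral \<beta> \<rho> s))" for s
  proof -
    have "?q s = (\<integral>\<^sup>+r. ennreal (?w s) * ennreal (?K s r) \<partial>lborel)"
      by (simp only: ennreal_mult' mult_nonneg_nonneg powr_ge_zero indicator_pos_le)
    also have "\<dots> = ennreal (?w s) * ennreal (\<integral>r. ?K s r \<partial>lborel)"
      by (subst nn_integral_cmult, measurable)
        (subst nn_integral_eq_integral[OF integrable_RL_integrand], simp_all add: nonneg)
    also have "(\<integral>r. ?K s r \<partial>lborel) = Gamma \<beta> * RL_integral \<beta> \<rho> s"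
      using G by (simp add: RL_integral_lborel zero)
    finally show ?thesis by (simp only: ennreal_mult' mult_nonneg_nonneg powr_ge_zero indicator_pos_le)
  qed
  have meas: "?q \<in> borel_measurable lborel"
  proof -
    have "?q = (\<lambda>s. \<integral>\<^sup>+r. ennreal (?w s * ((if 0 < r \<and> r < s then 1 else 0) * ((s - r) powr (\<beta> - 1) * \<rho> r))) \<partial>lborel)"
      by (intro ext nn_integral_cong) (auto simp: indicator_def)
    also have "\<dots> \<in> borel_measurable lborel" by measurable
    finally show ?thesis .
  qed
  have "(\<integral>\<^sup>+s. ennreal (indicator {0<..<t} s * ((t - s) powr (- \<beta>) * solution c s)) \<partial>lborel)
      = (\<integral>\<^sup>+s. ennreal c * ?p s + ennreal (1 / Gamma \<beta>) * ?q s \<partial>lborel)"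
  proof (rule nn_integral_cong)
    fix s
    have "indicator {0<..<t} s * ((t - s) powr (- \<beta>) * solution c s)
      = c * (indicator {0<..<t} s * ((s - 0) powr (\<beta> - 1) * (t - s) powr (1 - \<beta> - 1)))
        + 1 / Gamma \<beta> * (?w s * (Gamma \<beta> * RL_integral \<beta> \<rho> s))"
      using G by (auto simp: indicator_def solution_def algebra_simps)
    then show "ennreal (indicator {0<..<t} s * ((t - s) powr (- \<beta>) * solution c s))
        = ennreal c * ?p s + ennreal (1 / Gamma \<beta>) * ?q s"
      unfolding q using c G RL_nonneg[of s]
      by (simp only: ennreal_linear_combination mult_nonneg_nonneg powr_ge_zero indicator_pos_le
          zero_le_divide_1_iff less_imp_le)
  qed
  also have "\<dots> = ennreal c * (\<integral>\<^sup>+s. ?p s \<partial>lborel) + ennreal (1 / Gamma \<beta>) * (\<integral>\<^sup>+s. ?q s \<partial>lborel)"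
    using meas by (simp add: nn_integral_add nn_integral_cmult)
  also have "(\<integral>\<^sup>+s. ?p s \<partial>lborel) = ennreal (Beta \<beta> (1 - \<beta>))"
    using \<beta> t by (subst nn_integral_Beta_interval) auto
  also have "(\<integral>\<^sup>+s. ?q s \<partial>lborel) = ennreal (Beta \<beta> (1 - \<beta>) * mass t)"
    by (rule nn_integral_iterated_kernel)
  also have "Beta \<beta> (1 - \<beta>) = Gamma \<beta> * Gamma (1 - \<beta>)" by (simp add: Beta_def)
  also have "ennreal c * ennreal (Gamma \<beta> * Gamma (1 - \<beta>)) + ennreal (1 / Gamma \<beta>) * ennreal (Gamma \<beta> * Gamma (1 - \<beta>) * mass t)
     = ennreal (c * (Gamma \<beta> * Gamma (1 - \<beta>)) + 1 / Gamma \<beta> * (Gamma \<beta> * Gamma (1 - \<beta>) * mass t))"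
    using c G mass_nonneg[of t] by (subst ennreal_linear_combination) simp_all
  also have "c * (Gamma \<beta> * Gamma (1 - \<beta>)) + 1 / Gamma \<beta> * (Gamma \<beta> * Gamma (1 - \<beta>) * mass t)
     = Gamma (1 - \<beta>) * (c * Gamma \<beta> + mass t)"
    using G by (simp add: field_simps)
  finally show ?thesis .
qed

lemma RL_integrable_solution: "0 \<le> c \<Longrightarrow> RL_integrable (1 - \<beta>) (solution c)"
  unfolding RL_integrable_def
proof (intro allI impI)
  fix t :: real assume "0 < t" "0 \<le> c"
  then show "set_integrable lebesgue {0..t} (\<lambda>s. (t - s) powr (1 - \<beta> - 1) * solution c s)"
    by (subst RL_integrand_integrable_lborel)
      (auto simp: solution_def[of _ 0] solution_nonneg intro!: integrableI_nn_integral_finite nn_integral_solution)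
qed

lemma RL_integral_solution:
  assumes "0 < t" "0 \<le> c"
  shows "RL_integral (1 - \<beta>) (solution c) t = c * Gamma \<beta> + mass t"
proof -
  have G: "0 < Gamma \<beta>" "0 < Gamma (1 - \<beta>)" using \<beta> by (simp_all add: Gamma_real_pos)
  have "(\<integral>s. indicator {0<..<t} s * ((t - s) powr (- \<beta>) * solution c s) \<partial>lborel)
      = Gamma (1 - \<beta>) * (c * Gamma \<beta> + mass t)"
    using G assms mass_nonneg[of t] nn_integral_solution[OF assms]
    by (subst integral_eq_nn_integral) (simp_all add: solution_nonneg)
  then show ?thesis using G by (simp add: RL_integral_lborel solution_def[of _ 0])
qed

lemma mass_diff:
  assumes "0 < u" "u \<le> v"
  shows "mass v - mass u = (\<integral>s. indicator {u..<v} s * \<rho> s \<partial>lborel)"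
proof -
  have "mass v - mass u = (\<integral>s. indicator {0<..<v} s * \<rho> s - indicator {0<..<u} s * \<rho> s \<partial>lborel)"
    unfolding mass_def by (intro Bochner_Integration.integral_diff[symmetric] integrable_forcing)
  also have "(\<lambda>s. indicator {0<..<v} s * \<rho> s - indicator {0<..<u} s * \<rho> s) = (\<lambda>s. indicator {u..<v} s * \<rho> s)"
    using assms by (auto simp: indicator_def fun_eq_iff)
  finally show ?thesis .
qed

text \<open>The Henstock-Kurzweil form of the fundamental theorem of calculus is applied on a compact
  interval that avoids the singularity of \<open>\<rho>\<close> at 0.\<close>

lemma mass_has_derivative:
  assumes cont: "continuous_on {0<..} \<rho>" and t: "0 < t"
  shows "(mass has_real_derivative \<rho> t) (at t)"
proof -
  let ?a = "t / 2" and ?b = "t + 1"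
  have sub: "{?a..?b} \<subseteq> {0<..}" using t by auto
  have c: "continuous_on {?a..?b} \<rho>" by (rule continuous_on_subset[OF cont sub])
  have eq: "mass ?a + integral {?a..y} \<rho> = mass y" if y: "y \<in> {?a..?b}" for y
  proof -
    have cy: "continuous_on {?a..y} \<rho>" using y by (intro continuous_on_subset[OF c]) auto
    have "integral {?a..y} \<rho> = (\<integral>s. indicator {?a..y} s * \<rho> s \<partial>lborel)"
      using set_borel_integral_eq_integral(2)[OF borel_integrable_atLeastAtMost', OF cy]
      by (simp add: set_lebesgue_integral_def)
    also have "\<dots> = (\<integral>s. indicator {?a..<y} s * \<rho> s \<partial>lborel)"
    proof (rule integral_cong_AE)
      show "AE s in lborel. indicator {?a..y} s * \<rho> s = indicator {?a..<y} s * \<rho> s"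
        using AE_lborel_singleton[of y] by eventually_elim (auto simp: indicator_def)
    qed measurable
    also have "\<dots> = mass y - mass ?a" using t y by (subst mass_diff) auto
    finally show ?thesis by simp
  qed
  have "((\<lambda>y. mass ?a + integral {?a..y} \<rho>) has_real_derivative \<rho> t) (at t within {?a..?b})"
    using t by (auto intro!: derivative_eq_intros integral_has_real_derivative c)
  then have "(mass has_real_derivative \<rho> t) (at t within {?a..?b})"
    by (rule has_field_derivative_transform_within[where d = 1]) (use t eq in auto)
  then show ?thesis using t by (subst (asm) at_within_Icc_at) auto
qed

end

section \<open>Absolute continuity of indefinite integrals\<close>

text \<open>Truncating \<open>f\<close> at a high level \<open>n\<close> removes at most \<open>\<epsilon> / 2\<close> of its integral, and the
  truncated function has an integral of at most \<open>n\<close> times the measure of \<open>A\<close>.\<close>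

lemma absolutely_continuous_indefinite_integral:
  fixes f :: "real \<Rightarrow> real"
  assumes f: "integrable lborel f" and nonneg: "\<And>s. 0 \<le> f s" and \<epsilon>: "0 < \<epsilon>"
  obtains d where "0 < d"
    "\<And>A. A \<in> sets borel \<Longrightarrow> emeasure lborel A < \<infinity> \<Longrightarrow> measure lborel A < d \<Longrightarrow> (\<integral>s. indicator A s * f s \<partial>lborel) < \<epsilon>"
proof -
  have [measurable]: "f \<in> borel_measurable borel" using f by simp
  have "(\<lambda>n. \<integral>s. min (f s) (real n) \<partial>lborel) \<longlonglongrightarrow> (\<integral>s. f s \<partial>lborel)"
  proof (rule integral_dominated_convergence[OF _ _ f])
    show "AE s in lborel. (\<lambda>n. min (f s) (real n)) \<longlonglongrightarrow> f s"
    proof (rule AE_I2)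
      fix s
      obtain N where "f s \<le> real N" using real_arch_simple by blast
      then have "\<forall>n\<ge>N. min (f s) (real n) = f s" by (auto simp: min_def)
      then show "(\<lambda>n. min (f s) (real n)) \<longlonglongrightarrow> f s"
        by (intro tendsto_eventually) (auto simp: eventually_sequentially)
    qed
    show "AE s in lborel. norm (min (f s) (real n)) \<le> f s" for n
      using nonneg by (intro AE_I2) auto
  qed measurable
  from order_tendstoD(1)[OF this, of "(\<integral>s. f s \<partial>lborel) - \<epsilon> / 2"] \<epsilon>
  obtain n where n: "(\<integral>s. f s \<partial>lborel) - \<epsilon> / 2 < (\<integral>s. min (f s) (real n) \<partial>lborel)"
    by (auto simp: eventually_sequentially)
  have im: "integrable lborel (\<lambda>s. min (f s) (real n))"
    using f nonneg by (intro Bochner_Integration.integrable_bound[OF f]) auto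
  show ?thesis
  proof (rule that[of "\<epsilon> / (2 * (real n + 1))"])
    show "0 < \<epsilon> / (2 * (real n + 1))" using \<epsilon> by simp
    fix A :: "real set"
    assume A [measurable]: "A \<in> sets borel" and fin: "emeasure lborel A < \<infinity>"
      and small: "measure lborel A < \<epsilon> / (2 * (real n + 1))"
    have iA: "integrable lborel (\<lambda>s. real n * indicator A s :: real)"
      using fin by (intro integrable_mult_right) (simp add: integrable_indicator_iff)
    have "(\<integral>s. indicator A s * f s \<partial>lborel) \<le> (\<integral>s. (f s - min (f s) (real n)) + real n * indicator A s \<partial>lborel)"
    proof (rule integral_mono)
      show "integrable lborel (\<lambda>s. indicator A s * f s)"
        using f by (simp add: integrable_real_mult_indicator mult.commute)
      show "integrable lborel (\<lambda>s. (f s - min (f s) (real n)) + real n * indicator A s)"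
        using f im iA by simp
    qed (use nonneg in \<open>auto simp: indicator_def\<close>)
    also have "\<dots> = (\<integral>s. f s \<partial>lborel) - (\<integral>s. min (f s) (real n) \<partial>lborel) + real n * measure lborel A"
      using f im iA fin by simp
    also have "\<dots> < \<epsilon> / 2 + real n * measure lborel A" using n by simp
    also have "\<dots> \<le> \<epsilon> / 2 + (real n + 1) * (\<epsilon> / (2 * (real n + 1)))"
      using small by (intro add_left_mono mult_mono) auto
    also have "\<dots> = \<epsilon>" by (simp add: field_simps)
    finally show "(\<integral>s. indicator A s * f s \<partial>lborel) < \<epsilon>" .
  qed
qed

lemma abs_continuous_on_cong:
  assumes f: "abs_continuous_on S f" and eq: "\<And>s. s \<in> S \<Longrightarrow> g s = f s"
  shows "abs_continuous_on S g"
proof -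
  have "(\<Sum>(u, v)\<in>I. \<bar>g v - g u\<bar>) = (\<Sum>(u, v)\<in>I. \<bar>f v - f u\<bar>)"
    if "\<forall>(u, v)\<in>I. u \<le> v \<and> {u..v} \<subseteq> S" for I
    using that by (intro sum.cong) (auto simp: eq subset_iff)
  then show ?thesis using f unfolding abs_continuous_on_def by (metis (no_types, lifting))
qed

context decreasing_forcing begin

text \<open>The total increment over a family of disjoint intervals is the integral of \<open>\<rho>\<close> over
  their union.\<close>

lemma mass_abs_continuous: "abs_continuous_on {0<..T} (\<lambda>t. C + mass t)"
  unfolding abs_continuous_on_def
proof (intro allI impI)
  fix \<epsilon> :: real assume "0 < \<epsilon>"
  let ?f = "\<lambda>s. indicator {0<..<T} s * \<rho> s"
  obtain d where d: "0 < d"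
    "\<And>A. A \<in> sets borel \<Longrightarrow> emeasure lborel A < \<infinity> \<Longrightarrow> measure lborel A < d \<Longrightarrow> (\<integral>s. indicator A s * ?f s \<partial>lborel) < \<epsilon>"
    using absolutely_continuous_indefinite_integral[OF integrable_forcing[of T] _ \<open>0 < \<epsilon>\<close>] nonneg by auto
  show "\<exists>\<delta>>0. \<forall>I :: (real \<times> real) set.
        finite I \<and> (\<forall>(u, v)\<in>I. u \<le> v \<and> {u..v} \<subseteq> {0<..T}) \<and>
        pairwise (\<lambda>(u, v) (u', v'). {u<..<v} \<inter> {u'<..<v'} = {}) I \<and>
        (\<Sum>(u, v)\<in>I. v - u) < \<delta>
        \<longrightarrow> (\<Sum>(u, v)\<in>I. \<bar>(C + mass v) - (C + mass u)\<bar>) < \<epsilon>"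
  proof (intro exI[of _ d] conjI allI impI d(1))
    fix I :: "(real \<times> real) set"
    assume "finite I \<and> (\<forall>(u, v)\<in>I. u \<le> v \<and> {u..v} \<subseteq> {0<..T}) \<and>
        pairwise (\<lambda>(u, v) (u', v'). {u<..<v} \<inter> {u'<..<v'} = {}) I \<and> (\<Sum>(u, v)\<in>I. v - u) < d"
    then have fin: "finite I" and sub: "\<And>u v. (u, v) \<in> I \<Longrightarrow> u \<le> v \<and> 0 < u \<and> v \<le> T"
      and disj: "pairwise (\<lambda>(u, v) (u', v'). {u<..<v} \<inter> {u'<..<v'} = {}) I"
      and small: "(\<Sum>(u, v)\<in>I. v - u) < d"
      by (auto simp: subset_iff)
    define A :: "real \<times> real \<Rightarrow> real set" where "A i = {fst i<..<snd i}" for i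
    have dA: "disjoint_family_on A I"
      using disj unfolding disjoint_family_on_def pairwise_def A_def case_prod_beta by blast
    have mA: "A i \<in> sets borel" for i by (simp add: A_def)
    have eA: "emeasure lborel (A i) = ennreal (snd i - fst i)" if "i \<in> I" for i
      using sub[of "fst i" "snd i"] that by (simp add: A_def)
    have "emeasure lborel (\<Union>i\<in>I. A i) = (\<Sum>i\<in>I. emeasure lborel (A i))"
      using dA fin mA by (intro sum_emeasure[symmetric]) auto
    also have "\<dots> = (\<Sum>i\<in>I. ennreal (snd i - fst i))" by (intro sum.cong refl eA)
    also have "\<dots> = ennreal (\<Sum>i\<in>I. snd i - fst i)"
      using sub by (intro sum_ennreal) force
    finally have e: "emeasure lborel (\<Union>i\<in>I. A i) = ennreal (\<Sum>i\<in>I. snd i - fst i)" .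
    have nn: "0 \<le> (\<Sum>i\<in>I. snd i - fst i)" using sub by (intro sum_nonneg) force
    have "(\<Sum>(u, v)\<in>I. \<bar>(C + mass v) - (C + mass u)\<bar>) = (\<Sum>i\<in>I. \<integral>s. indicator (A i) s * ?f s \<partial>lborel)"
    proof (rule sum.cong)
      fix i assume "i \<in> I"
      obtain u v where i: "i = (u, v)" by (cases i)
      with sub \<open>i \<in> I\<close> have uv: "u \<le> v" "0 < u" "v \<le> T" by auto
      have "mass v - mass u = (\<integral>s. indicator {u..<v} s * \<rho> s \<partial>lborel)" using uv by (intro mass_diff) auto
      also have "\<dots> = (\<integral>s. indicator (A i) s * ?f s \<partial>lborel)"
      proof (rule integral_cong_AE)
        show "AE s in lborel. indicator {u..<v} s * \<rho> s = indicator (A i) s * ?f s"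
          using AE_lborel_singleton[of u] by eventually_elim (use uv in \<open>auto simp: indicator_def A_def i\<close>)
      qed (use mA in measurable)
      finally have "mass v - mass u = (\<integral>s. indicator (A i) s * ?f s \<partial>lborel)" .
      moreover have "0 \<le> (\<integral>s. indicator (A i) s * ?f s \<partial>lborel)"
        by (intro integral_nonneg_AE AE_I2) (simp add: nonneg)
      ultimately show "(case i of (u, v) \<Rightarrow> \<bar>(C + mass v) - (C + mass u)\<bar>) = (\<integral>s. indicator (A i) s * ?f s \<partial>lborel)"
        by (simp add: i)
    qed simp
    also have "\<dots> = (\<integral>s. indicator (\<Union>i\<in>I. A i) s * ?f s \<partial>lborel)"
    proof -
      have "integrable lborel (\<lambda>s. indicator (A i) s * ?f s)" for i
        using integrable_mult_indicator[OF _ integrable_forcing, of "A i" T] mA by simp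
      then show ?thesis
        using set_integral_finite_Union[OF fin dA, of lborel ?f] mA
        by (simp add: set_lebesgue_integral_def set_integrable_def)
    qed
    also have "\<dots> < \<epsilon>"
    proof (rule d(2))
      show "(\<Union>i\<in>I. A i) \<in> sets borel" using fin mA by auto
      show "emeasure lborel (\<Union>i\<in>I. A i) < \<infinity>" by (simp add: e)
      show "measure lborel (\<Union>i\<in>I. A i) < d"
        using small nn by (simp add: measure_def e case_prod_beta)
    qed
    finally show "(\<Sum>(u, v)\<in>I. \<bar>(C + mass v) - (C + mass u)\<bar>) < \<epsilon>" .
  qed
qed


end

section \<open>Qualitative properties of the solution of the linear problem\<close>

context decreasing_forcing begin

lemma solution_continuous: "continuous_on {0<..} (solution c)"
proof -
  have "continuous_on {0<..} (\<lambda>s. c * s powr (\<beta> - 1) + RL_integral \<beta> \<rho> s)"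
    by (intro continuous_intros RL_continuous) auto
  then show ?thesis
    by (rule continuous_on_cong[THEN iffD1, rotated -1]) (auto simp: solution_def)
qed

lemma solution_antimono:
  assumes "0 \<le> c" shows "antimono_on {0<..} (solution c)"
proof (rule monotone_onI)
  fix s t :: real assume st: "s \<in> {0<..}" "t \<in> {0<..}" "s \<le> t"
  have "c * t powr (\<beta> - 1) \<le> c * s powr (\<beta> - 1)"
    using st assms \<beta> by (intro mult_left_mono powr_mono2') auto
  moreover have "RL_integral \<beta> \<rho> t \<le> RL_integral \<beta> \<rho> s"
    using RL_antimono st by (auto simp: monotone_on_def)
  ultimately show "solution c t \<le> solution c s" using st by (simp add: solution_def)
qed

lemma solution_strict_antimono:
  assumes "0 < c" shows "strict_antimono_on {0<..} (solution c)"
proof (rule monotone_onI)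
  fix s t :: real assume st: "s \<in> {0<..}" "t \<in> {0<..}" "s < t"
  have "c * t powr (\<beta> - 1) < c * s powr (\<beta> - 1)"
    using st assms \<beta> by (intro mult_strict_left_mono powr_less_mono2_neg) auto
  moreover have "RL_integral \<beta> \<rho> t \<le> RL_integral \<beta> \<rho> s"
    using RL_antimono st by (auto simp: monotone_on_def)
  ultimately show "solution c t < solution c s" using st by (simp add: solution_def)
qed

text \<open>By the bound \<open>RL_bound\<close>, the fractional integral contributes at most a multiple of
  \<open>t powr \<delta>\<close> to \<open>t powr (1 - \<beta>) * solution c t\<close>.\<close>

lemma solution_limit: "((\<lambda>t. t powr (1 - \<beta>) * solution c t) \<longlongrightarrow> c) (at_right 0)"
proof -
  let ?C = "H * Beta \<delta> \<beta> / Gamma \<beta>"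
  have ev: "\<forall>\<^sub>F t in at_right (0::real). 0 < t \<and> t \<le> 1"
    using eventually_at_right_real[OF zero_less_one] by eventually_elim auto
  have "((\<lambda>t. t powr (1 - \<beta>) * RL_integral \<beta> \<rho> t) \<longlongrightarrow> 0) (at_right 0)"
  proof (rule tendsto_sandwich)
    show "\<forall>\<^sub>F t in at_right 0. 0 \<le> t powr (1 - \<beta>) * RL_integral \<beta> \<rho> t"
      by (simp add: RL_nonneg)
    show "\<forall>\<^sub>F t in at_right 0. t powr (1 - \<beta>) * RL_integral \<beta> \<rho> t \<le> ?C * t powr \<delta>"
      using ev
    proof eventually_elim
      case (elim t)
      have "t powr (1 - \<beta>) * RL_integral \<beta> \<rho> t \<le> t powr (1 - \<beta>) * (?C * t powr (\<beta> + \<delta> - 1))"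
        using elim by (intro mult_left_mono RL_bound) auto
      also have "\<dots> = ?C * (t powr (1 - \<beta>) * t powr (\<beta> + \<delta> - 1))" by (simp only: mult_ac)
      also have "t powr (1 - \<beta>) * t powr (\<beta> + \<delta> - 1) = t powr \<delta>" by (simp flip: powr_add)
      finally show ?case .
    qed
    have "((\<lambda>t. t powr \<delta>) \<longlongrightarrow> 0 powr \<delta>) (at_right (0::real))"
      using \<delta> by (intro tendsto_powr' tendsto_intros) (auto simp: eventually_at_filter)
    from tendsto_mult[OF tendsto_const[of ?C] this]
    show "((\<lambda>t. ?C * t powr \<delta>) \<longlongrightarrow> 0) (at_right 0)" by simp
  qed simp
  then have "((\<lambda>t. c + t powr (1 - \<beta>) * RL_integral \<beta> \<rho> t) \<longlongrightarrow> c + 0) (at_right 0)"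
    by (intro tendsto_intros)
  moreover have "\<forall>\<^sub>F t in at_right 0. c + t powr (1 - \<beta>) * RL_integral \<beta> \<rho> t = t powr (1 - \<beta>) * solution c t"
    using ev
  proof eventually_elim
    case (elim t)
    have "t powr (1 - \<beta>) * t powr (\<beta> - 1) = 1" using elim by (simp flip: powr_add)
    then show ?case using elim by (simp add: solution_def algebra_simps)
  qed
  ultimately have "((\<lambda>t. t powr (1 - \<beta>) * solution c t) \<longlongrightarrow> c + 0) (at_right 0)"
    by (rule Lim_transform_eventually)
  then show ?thesis by simp
qed

lemma solution_in_C_plus:
  assumes "0 \<le> c" shows "solution c \<in> C_plus (1 - \<beta>)"
proof -
  define y where "y t = (if t = 0 then c else t powr (1 - \<beta>) * solution c t)" for t
  have "continuous_on {0..} y"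
    unfolding continuous_on_def
  proof
    fix t :: real assume t: "t \<in> {0..}"
    show "(y \<longlongrightarrow> y t) (at t within {0..})"
    proof (cases "t = 0")
      case True
      have "\<forall>\<^sub>F t in at_right (0::real). t powr (1 - \<beta>) * solution c t = y t"
        by (auto simp: y_def eventually_at_filter)
      then have "(y \<longlongrightarrow> c) (at_right 0)" by (rule Lim_transform_eventually[OF solution_limit])
      then show ?thesis using True by (simp add: y_def at_within_Ici_at_right)
    next
      case False
      then have "t \<in> {0<..}" using t by simp
      have "continuous_on {0<..} (\<lambda>t. t powr (1 - \<beta>) * solution c t)"
        by (intro continuous_intros solution_continuous) auto
      then have "continuous_on {0<..} y"
        by (rule continuous_on_cong[THEN iffD1, rotated -1]) (auto simp: y_def)
      then have "isCont y t" using \<open>t \<in> {0<..}\<close> by (simp add: continuous_on_eq_continuous_at)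
      then show ?thesis by (simp add: isCont_def tendsto_within_subset[OF _ subset_UNIV])
    qed
  qed
  moreover have "\<forall>t\<ge>0. 0 \<le> y t" using assms by (simp add: y_def solution_nonneg)
  moreover have "\<forall>t>0. y t = t powr (1 - \<beta>) * solution c t" by (simp add: y_def)
  ultimately show ?thesis
    using assms solution_continuous solution_nonneg unfolding C_plus_def by blast
qed

lemma solution_has_RL_derivative:
  assumes cont: "continuous_on {0<..} \<rho>" and c: "0 \<le> c" and t: "0 < t"
  shows "has_RL_derivative \<beta> (solution c) (\<rho> t) t"
  unfolding has_RL_derivative_def
proof (intro conjI allI impI)
  show "RL_integrable (1 - \<beta>) (solution c)" by (rule RL_integrable_solution[OF c])
  have eq: "RL_integral (1 - \<beta>) (solution c) s = c * Gamma \<beta> + mass s" if "0 < s" for s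
    using RL_integral_solution[OF that c] .
  show "abs_continuous_on {0<..T} (RL_integral (1 - \<beta>) (solution c))" for T
  proof (rule abs_continuous_on_cong[OF mass_abs_continuous])
    show "RL_integral (1 - \<beta>) (solution c) s = c * Gamma \<beta> + mass s" if "s \<in> {0<..T}" for s
      using that eq by simp
  qed
  have "((\<lambda>s. c * Gamma \<beta> + mass s) has_real_derivative \<rho> t) (at t)"
    by (auto intro!: derivative_eq_intros mass_has_derivative[OF cont t])
  then show "(RL_integral (1 - \<beta>) (solution c) has_real_derivative \<rho> t) (at t)"
    by (rule has_field_derivative_transform_within_open[where S = "{0<..}"]) (use t eq in auto)
qed

end

section \<open>From integrability to pointwise bounds\<close>

text \<open>On \<open>[t / 2, t]\<close> the function \<open>L s = s powr a * f s\<close> is at least a fixed multiple of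
  \<open>L t\<close>, because \<open>s powr b * f s\<close> is nonincreasing and powers of \<open>s\<close> and \<open>t\<close> are comparable
  there. Hence \<open>t * L t powr p\<close> is bounded by a multiple of the integral of \<open>L powr p\<close>.\<close>

lemma Lp_antimono_pointwise_bound:
  fixes f :: "real \<Rightarrow> real"
  assumes p: "0 < p"
    and nonneg: "\<forall>t>0. 0 \<le> t powr b * f t"
    and anti: "antimono_on {0<..} (\<lambda>t. t powr b * f t)"
    and Lp: "in_Lp p {0..1} (\<lambda>t. t powr a * f t)"
  obtains C where "0 \<le> C" "\<And>t. 0 < t \<Longrightarrow> t \<le> 1 \<Longrightarrow> f t \<le> C * t powr (- a - 1 / p)"
proof -
  define L where "L t = t powr a * f t" for t
  define N where "N = (\<integral>s. indicator {0..1} s * \<bar>L s\<bar> powr p \<partial>lebesgue)"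
  define c where "c = min 1 ((1 / 2) powr (a - b))"
  have c: "0 < c" by (simp add: c_def)
  have int: "integrable lebesgue (\<lambda>s. indicator {0..1} s * \<bar>L s\<bar> powr p)"
    using Lp by (simp add: in_Lp_def set_integrable_def L_def)
  have L_eq: "L t = t powr (a - b) * (t powr b * f t)" if "0 < t" for t
    by (simp add: L_def powr_diff)
  have L0: "0 \<le> L t" if "0 < t" for t
    using nonneg that by (simp add: L_eq)
  have low: "c * L t \<le> L s" if t: "0 < t" and s: "t / 2 \<le> s" "s \<le> t" for s t
  proof -
    have s0: "0 < s" using t s by linarith
    have "c \<le> (s / t) powr (a - b)"
    proof (cases "0 \<le> a - b")
      case True
      have "(1 / 2) powr (a - b) \<le> (s / t) powr (a - b)"
        using True t s by (intro powr_mono2) (auto simp: field_simps)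
      then show ?thesis by (simp add: c_def)
    next
      case False
      have "1 powr (a - b) \<le> (s / t) powr (a - b)"
        using False t s s0 by (intro powr_mono2') (auto simp: field_simps)
      then show ?thesis by (simp add: c_def)
    qed
    then have "c * t powr (a - b) \<le> (s / t) powr (a - b) * t powr (a - b)"
      by (intro mult_right_mono) auto
    also have "\<dots> = s powr (a - b)"
      using t s0 by (simp add: powr_divide)
    finally have 1: "c * t powr (a - b) \<le> s powr (a - b)" .
    have 2: "t powr b * f t \<le> s powr b * f s"
      using anti s s0 t by (auto simp: monotone_on_def)
    have "(c * t powr (a - b)) * (t powr b * f t) \<le> s powr (a - b) * (s powr b * f s)"
      using nonneg t by (intro mult_mono[OF 1 2]) auto
    then show ?thesis using t s0 by (simp add: L_eq)
  qed
  have N0: "0 \<le> N" unfolding N_def by (intro integral_nonneg_AE AE_I2) auto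
  have bnd: "f t \<le> (2 * N) powr (1 / p) / c * t powr (- a - 1 / p)" if t: "0 < t" "t \<le> 1" for t
  proof -
    have "(c * L t) powr p * (t / 2) = (\<integral>s. indicator {t / 2..t} s * (c * L t) powr p \<partial>lebesgue)"
      using t by (simp add: measure_def)
    also have "\<dots> \<le> N" unfolding N_def
    proof (rule integral_mono)
      show "integrable lebesgue (\<lambda>s. indicator {t / 2..t} s * (c * L t) powr p)"
        using t by (intro integrable_mult_left) (simp add: integrable_indicator_iff)
      show "indicator {t / 2..t} s * (c * L t) powr p \<le> indicator {0..1} s * \<bar>L s\<bar> powr p" for s
      proof (cases "s \<in> {t / 2..t}")
        case True
        then have "(c * L t) powr p \<le> \<bar>L s\<bar> powr p"
          using low[of t s] L0[of t] c t p by (intro powr_mono2) auto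
        then show ?thesis using True t by (auto simp: indicator_def)
      qed auto
    qed (rule int)
    finally have "(c * L t) powr p \<le> 2 * N / t" using t by (simp add: field_simps)
    then have "((c * L t) powr p) powr (1 / p) \<le> (2 * N / t) powr (1 / p)"
      using p by (intro powr_mono2) auto
    also have "((c * L t) powr p) powr (1 / p) = c * L t"
      using p c L0[of t] t by (simp add: powr_powr)
    also have "(2 * N / t) powr (1 / p) = (2 * N) powr (1 / p) * t powr (- (1 / p))"
      using t N0 by (simp add: powr_divide powr_minus field_simps)
    finally have "L t \<le> (2 * N) powr (1 / p) / c * t powr (- (1 / p))"
      using c by (simp add: field_simps)
    then have "t powr (- a) * L t \<le> t powr (- a) * ((2 * N) powr (1 / p) / c * t powr (- (1 / p)))"
      by (intro mult_left_mono) auto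
    also have "t powr (- a) * L t = f t" using t by (simp add: L_def powr_minus)
    also have "t powr (- a) * ((2 * N) powr (1 / p) / c * t powr (- (1 / p)))
        = (2 * N) powr (1 / p) / c * (t powr (- a) * t powr (- (1 / p)))" by (simp only: mult_ac)
    also have "t powr (- a) * t powr (- (1 / p)) = t powr (- a - 1 / p)"
      by (simp flip: powr_add)
    finally show ?thesis .
  qed
  show ?thesis by (rule that[OF _ bnd]) (use c in auto)
qed

section \<open>Fixed points of order preserving operators\<close>

text \<open>The argument of Knaster and Tarski: the pointwise supremum of all \<open>z\<close> with \<open>z \<le> T z\<close> is a
  fixed point. The class is closed under pointwise suprema, and the barrier \<open>U\<close> makes them
  finite.\<close>

lemma antimono_fixed_point:
  fixes T :: "('a::preorder \<Rightarrow> real) \<Rightarrow> 'a \<Rightarrow> real" and U :: "'a \<Rightarrow> real" and S :: "'a set"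
  defines "\<C> \<equiv> {x. (\<forall>t. 0 \<le> x t \<and> x t \<le> U t) \<and> antimono_on S x}"
  assumes U: "\<And>t. 0 \<le> U t"
    and maps: "\<And>x. x \<in> \<C> \<Longrightarrow> T x \<in> \<C>"
    and mono: "\<And>x y t. x \<in> \<C> \<Longrightarrow> y \<in> \<C> \<Longrightarrow> (\<And>s. x s \<le> y s) \<Longrightarrow> T x t \<le> T y t"
  shows "\<exists>x\<in>\<C>. T x = x"
proof -
  define Z where "Z = {z \<in> \<C>. \<forall>t. z t \<le> T z t}"
  define x where "x t = (SUP z\<in>Z. z t)" for t
  have zero: "(\<lambda>_. 0) \<in> \<C>" using U by (auto simp: \<C>_def monotone_on_def)
  have ZC: "z \<in> \<C>" if "z \<in> Z" for z using that by (simp add: Z_def)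
  have zZ: "(\<lambda>_. 0) \<in> Z" using zero maps[OF zero] by (auto simp: Z_def \<C>_def)
  have upper: "z t \<le> x t" if "z \<in> Z" for z t
    unfolding x_def using that ZC
    by (intro cSUP_upper) (auto simp: \<C>_def bdd_above_def)
  have least: "x t \<le> B" if "\<And>z. z \<in> Z \<Longrightarrow> z t \<le> B" for t B
    unfolding x_def using zZ that by (intro cSUP_least) auto
  have xC: "x \<in> \<C>"
    unfolding \<C>_def
  proof (intro CollectI conjI allI monotone_onI)
    show "0 \<le> x t" for t using upper[OF zZ] .
    show "x t \<le> U t" for t using ZC by (intro least) (auto simp: \<C>_def)
    show "x t \<le> x s" if "s \<in> S" "t \<in> S" "s \<le> t" for s t
    proof (rule least)
      fix z assume "z \<in> Z"
      then have "z t \<le> z s" using ZC[of z] that by (auto simp: \<C>_def monotone_on_def)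
      also have "\<dots> \<le> x s" using upper \<open>z \<in> Z\<close> .
      finally show "z t \<le> x s" .
    qed
  qed
  have le: "x t \<le> T x t" for t
  proof (rule least)
    fix z assume "z \<in> Z"
    then have "z t \<le> T z t" by (simp add: Z_def)
    also have "\<dots> \<le> T x t" using \<open>z \<in> Z\<close> by (intro mono ZC xC upper)
    finally show "z t \<le> T x t" .
  qed
  have "T x \<in> Z" using maps[OF xC] mono[OF xC maps[OF xC] le] by (simp add: Z_def)
  then have "T x t \<le> x t" for t by (rule upper)
  with le have "T x = x" by (intro ext antisym)
  with xC show ?thesis by blast
qed

text \<open>As \<open>\<mu> < 1\<close>, the right-hand side outgrows the left-hand side; the witness satisfies
  \<open>R powr (1 - \<mu>) = A + B + 1\<close> and \<open>R \<ge> 1\<close>.\<close>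

lemma sublinear_supersolution:
  fixes A B \<mu> :: real
  assumes "0 \<le> A" "0 \<le> B" "0 \<le> \<mu>" "\<mu> < 1"
  obtains R where "0 < R" "A + B * R powr \<mu> \<le> R"
proof (rule that)
  let ?R = "(A + B + 1) powr (1 / (1 - \<mu>))"
  show "0 < ?R" using assms by simp
  have "1 powr \<mu> \<le> ?R powr \<mu>"
    using assms by (intro powr_mono2) (auto intro: ge_one_powr_ge_zero)
  then have "A * 1 \<le> A * ?R powr \<mu>" using assms by (intro mult_left_mono) auto
  moreover have "0 \<le> ?R powr \<mu>" by simp
  ultimately have "A + B * ?R powr \<mu> \<le> (A + B + 1) * ?R powr \<mu>"
    unfolding distrib_right by linarith
  also have "(A + B + 1) * ?R powr \<mu> = ?R"
  proof -
    have "A + B + 1 = ?R powr (1 - \<mu>)" using assms by (simp add: powr_powr)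
    then have "(A + B + 1) * ?R powr \<mu> = ?R powr (1 - \<mu>) * ?R powr \<mu>" by (rule arg_cong)
    also have "\<dots> = ?R" using assms by (simp flip: powr_add)
    finally show ?thesis .
  qed
  finally show "A + B * ?R powr \<mu> \<le> ?R" .
qed

section \<open>Existence of a decreasing solution\<close>

theorem theorem3p1:
  fixes \<beta> x0 \<mu> p :: real and \<phi> l k :: "real \<Rightarrow> real"
  assumes "0 < \<beta>" "\<beta> < 1" and "x0 > 0" and "0 \<le> \<mu>" "\<mu> < 1" and "p > 1 / \<beta>"
    and phi: "\<forall>t\<ge>0. 0 \<le> \<phi> t" "continuous_on {0..} \<phi>" "mono_on {0..} \<phi>"
      "\<exists>M\<ge>0. \<forall>t\<ge>0. \<bar>\<phi> t\<bar> \<le> M * rpower t \<mu>"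
    and l: "\<forall>t>0. 0 \<le> t powr \<beta> * l t" "continuous_on {0<..} (\<lambda>t. t powr \<beta> * l t)"
      "antimono_on {0<..} (\<lambda>t. t powr \<beta> * l t)"
      "in_Lp p {0..1} (\<lambda>t. t powr ((1 - \<mu>) * (1 - \<beta>)) * l t)"
    and k: "\<forall>t>0. 0 \<le> t powr \<beta> * k t" "continuous_on {0<..} (\<lambda>t. t powr \<beta> * k t)"
      "antimono_on {0<..} (\<lambda>t. t powr \<beta> * k t)"
      "in_Lp p {0..1} (\<lambda>t. t powr (1 - \<beta>) * k t)"
  shows "\<exists>x \<in> C_plus (1 - \<beta>). RL_solution \<beta> x0 l \<phi> k x \<and> strict_antimono_on {0<..} x"
proof -
  note \<beta> = \<open>0 < \<beta>\<close> \<open>\<beta> < 1\<close>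
  have p0: "0 < p" using \<beta> \<open>p > 1 / \<beta>\<close> by (metis divide_pos_pos less_trans zero_less_one)
  define \<delta> where "\<delta> = \<beta> - 1 / p"
  have \<delta>: "0 < \<delta>" using \<beta> p0 \<open>p > 1 / \<beta>\<close> by (simp add: \<delta>_def field_simps)
  obtain M where M: "0 \<le> M" "\<And>t. 0 \<le> t \<Longrightarrow> \<phi> t \<le> M * rpower t \<mu>"
    using phi(4) by (metis abs_ge_self order_trans)
  obtain Cl where Cl: "0 \<le> Cl" "\<And>t. 0 < t \<Longrightarrow> t \<le> 1 \<Longrightarrow> l t \<le> Cl * t powr (- ((1 - \<mu>) * (1 - \<beta>)) - 1 / p)"
    using Lp_antimono_pointwise_bound[OF p0 l(1,3,4)] by metis
  obtain Ck where Ck: "0 \<le> Ck" "\<And>t. 0 < t \<Longrightarrow> t \<le> 1 \<Longrightarrow> k t \<le> Ck * t powr (- (1 - \<beta>) - 1 / p)"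
    using Lp_antimono_pointwise_bound[OF p0 k(1,3,4)] by metis
  have l0: "0 \<le> l t" if "0 < t" for t using l(1) that by (auto simp: zero_le_mult_iff)
  have k0: "0 \<le> k t" if "0 < t" for t using k(1) that by (auto simp: zero_le_mult_iff)
  define B where "B = Beta \<delta> \<beta> / Gamma \<beta>"
  have B: "0 \<le> B" using \<beta> \<delta> by (simp add: B_def Beta_def Gamma_real_nonneg)
  obtain R where R: "0 < R" "(x0 + Ck * B) + (Cl * M * B) * R powr \<mu> \<le> R"
    using sublinear_supersolution[of "x0 + Ck * B" "Cl * M * B" \<mu>] assms(3-5) B Cl(1) Ck(1) M(1) by auto
  define H where "H = Cl * M * R powr \<mu> + Ck"
  have H: "0 \<le> H" using Cl(1) Ck(1) M(1) by (simp add: H_def)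
  have HR: "x0 + H * B \<le> R" using R(2) by (simp add: H_def algebra_simps)
  \<comment> \<open>The barrier: \<open>R\<close> is chosen so that the bound reproduces itself on \<open>(0, 1]\<close>, and the constant continuation is preserved because images under \<open>T\<close> are nonincreasing.\<close>
  define U where "U t = (if t \<le> 0 then 0 else if t \<le> 1 then R * t powr (\<beta> - 1) else R)" for t :: real
  define F where "F x s = (if 0 < s then l s * \<phi> (x s) + k s else 0)" for x s
  define T where "T x t = (if 0 < t then x0 * t powr (\<beta> - 1) + RL_integral \<beta> (F x) t else 0)" for x t
  let ?C = "{x. (\<forall>t. 0 \<le> x t \<and> x t \<le> U t) \<and> antimono_on {0<..} x}"
  have forcing: "decreasing_forcing \<beta> \<delta> H (F x)" if x: "x \<in> ?C" for x
  proof
    show "0 < \<beta>" "\<beta> < 1" "0 < \<delta>" by (fact \<beta> \<delta>)+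
    show "F x s = 0" if "s \<le> 0" for s using that by (simp add: F_def)
    show "0 \<le> F x s" for s using x phi(1) l0 k0 by (auto simp: F_def)
    show "antimono_on {0<..} (\<lambda>s. s powr \<beta> * F x s)"
    proof (rule monotone_onI)
      fix s t :: real assume st: "s \<in> {0<..}" "t \<in> {0<..}" "s \<le> t"
      have "x t \<le> x s" using x st by (auto simp: monotone_on_def)
      then have 1: "\<phi> (x t) \<le> \<phi> (x s)" using x phi(3) by (auto simp: monotone_on_def)
      have 2: "t powr \<beta> * l t \<le> s powr \<beta> * l s" using l(3) st by (auto simp: monotone_on_def)
      have "(t powr \<beta> * l t) * \<phi> (x t) \<le> (s powr \<beta> * l s) * \<phi> (x s)"
        using l(1) phi(1) x st by (intro mult_mono[OF 2 1]) auto
      moreover have "t powr \<beta> * k t \<le> s powr \<beta> * k s" using k(3) st by (auto simp: monotone_on_def)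
      ultimately show "t powr \<beta> * F x t \<le> s powr \<beta> * F x s"
        using st by (simp add: F_def distrib_left mult.assoc)
    qed
    show "F x s \<le> H * s powr (\<delta> - 1)" if s: "0 < s" "s \<le> 1" for s
    proof -
      have "x s \<le> U s" "0 \<le> x s" using x by auto
      then have xs: "0 \<le> x s" "x s \<le> R * s powr (\<beta> - 1)" using s by (simp_all add: U_def)
      \<comment> \<open>Passing to the barrier first keeps the argument of \<open>rpower\<close> positive, where it agrees with \<open>powr\<close> even for \<open>\<mu> = 0\<close>.\<close>
      have "\<phi> (x s) \<le> \<phi> (R * s powr (\<beta> - 1))"
        using xs R(1) phi(3) by (auto simp: monotone_on_def)
      also have "\<dots> \<le> M * rpower (R * s powr (\<beta> - 1)) \<mu>" using R(1) by (intro M(2)) simp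
      also have "rpower (R * s powr (\<beta> - 1)) \<mu> = R powr \<mu> * s powr ((\<beta> - 1) * \<mu>)"
        using R(1) s by (simp add: rpower_def powr_mult powr_powr)
      finally have "l s * \<phi> (x s) \<le> (Cl * s powr (- ((1 - \<mu>) * (1 - \<beta>)) - 1 / p)) * (M * (R powr \<mu> * s powr ((\<beta> - 1) * \<mu>)))"
        using s xs l0 phi(1) Cl by (intro mult_mono) auto
      also have "\<dots> = Cl * M * R powr \<mu> * (s powr (- ((1 - \<mu>) * (1 - \<beta>)) - 1 / p) * s powr ((\<beta> - 1) * \<mu>))"
        by (simp only: mult_ac)
      also have "s powr (- ((1 - \<mu>) * (1 - \<beta>)) - 1 / p) * s powr ((\<beta> - 1) * \<mu>)
          = s powr (- ((1 - \<mu>) * (1 - \<beta>)) - 1 / p + (\<beta> - 1) * \<mu>)" by (simp only: powr_add)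
      also have "- ((1 - \<mu>) * (1 - \<beta>)) - 1 / p + (\<beta> - 1) * \<mu> = \<delta> - 1"
        unfolding \<delta>_def by algebra
      finally have "l s * \<phi> (x s) \<le> Cl * M * R powr \<mu> * s powr (\<delta> - 1)" .
      moreover have "k s \<le> Ck * s powr (\<delta> - 1)"
      proof -
        have "- (1 - \<beta>) - 1 / p = \<delta> - 1" by (simp add: \<delta>_def)
        then show ?thesis using Ck(2)[OF s] by (simp only:)
      qed
      ultimately show ?thesis using s by (simp add: F_def H_def distrib_right)
    qed
  qed
  have "\<exists>x\<in>?C. T x = x"
  proof (rule antimono_fixed_point)
    show "0 \<le> U t" for t using R(1) by (simp add: U_def)
    show "T x \<in> ?C" if x: "x \<in> ?C" for x
    proof -
      interpret decreasing_forcing \<beta> \<delta> H "F x" by (rule forcing[OF x])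
      have T: "T x = solution x0" by (auto simp: T_def solution_def)
      have anti: "antimono_on {0<..} (T x)"
        unfolding T using \<open>x0 > 0\<close> by (intro solution_antimono) simp
      have small: "T x t \<le> R * t powr (\<beta> - 1)" if t: "0 < t" "t \<le> 1" for t
      proof -
        have "RL_integral \<beta> (F x) t \<le> H * B * t powr (\<beta> + \<delta> - 1)"
          using RL_bound[OF t] by (simp add: B_def)
        also have "\<dots> \<le> H * B * t powr (\<beta> - 1)"
          using t H B \<delta> by (intro mult_left_mono powr_mono') auto
        finally have "T x t \<le> (x0 + H * B) * t powr (\<beta> - 1)"
          using t by (simp add: T_def distrib_right)
        also have "\<dots> \<le> R * t powr (\<beta> - 1)" using HR by (intro mult_right_mono) auto
        finally show ?thesis .
      qed
      have "T x t \<le> U t" for t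
      proof -
        consider "t \<le> 0" | "0 < t" "t \<le> 1" | "1 < t" by linarith
        then show ?thesis
        proof cases
          case 3
          then have "T x t \<le> T x 1" using anti by (auto simp: monotone_on_def)
          also have "\<dots> \<le> R" using small[of 1] by simp
          finally show ?thesis using 3 by (simp add: U_def)
        qed (use small in \<open>auto simp: U_def T_def\<close>)
      qed
      moreover have "0 \<le> T x t" for t unfolding T using \<open>x0 > 0\<close> by (intro solution_nonneg) simp
      ultimately show ?thesis using anti by blast
    qed
    show "T x t \<le> T y t" if x: "x \<in> ?C" and y: "y \<in> ?C" and le: "\<And>s. x s \<le> y s" for x y t
    proof -
      have "F x s \<le> F y s" if "0 < s" for s
      proof -
        have "\<phi> (x s) \<le> \<phi> (y s)" using x y le phi(3) by (auto simp: monotone_on_def)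
        then show ?thesis using that l0 by (simp add: F_def mult_left_mono)
      qed
      then have "RL_integral \<beta> (F x) t \<le> RL_integral \<beta> (F y) t"
        by (rule RL_integral_mono[OF forcing[OF x] forcing[OF y]])
      then show ?thesis by (simp add: T_def)
    qed
  qed
  then obtain x where x: "x \<in> ?C" and fixed: "T x = x" by blast
  interpret decreasing_forcing \<beta> \<delta> H "F x" by (rule forcing[OF x])
  have sol: "x = solution x0" using fixed by (auto simp: T_def solution_def fun_eq_iff)
  have xc: "continuous_on {0<..} x" by (subst sol) (rule solution_continuous)
  \<comment> \<open>At the fixed point \<open>x\<close> is continuous, hence so is \<open>F x\<close>, as the derivative requires.\<close>
  have strip: "continuous_on {0<..} f" if "continuous_on {0<..} (\<lambda>t. t powr \<beta> * f t)" for f :: "real \<Rightarrow> real"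
  proof -
    have "continuous_on {0<..} (\<lambda>t. t powr (- \<beta>) * (t powr \<beta> * f t))"
      by (intro continuous_intros that) auto
    then show ?thesis
      by (rule continuous_on_cong[THEN iffD1, rotated -1]) (auto simp: powr_minus)
  qed
  have "continuous_on {0<..} (\<lambda>t. l t * \<phi> (x t) + k t)"
    by (intro continuous_on_add continuous_on_mult strip[OF l(2)] strip[OF k(2)]
        continuous_on_compose2[OF phi(2) xc]) (use x in auto)
  then have "continuous_on {0<..} (F x)"
    by (rule continuous_on_cong[THEN iffD1, rotated -1]) (auto simp: F_def)
  then have "\<forall>t>0. has_RL_derivative \<beta> (solution x0) (F x t) t"
    using \<open>x0 > 0\<close> by (intro allI impI solution_has_RL_derivative) auto
  then have "RL_solution \<beta> x0 l \<phi> k x"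
    using solution_limit[of x0] unfolding RL_solution_def sol[symmetric] by (simp add: F_def)
  moreover have "x \<in> C_plus (1 - \<beta>)"
    using solution_in_C_plus[of x0] \<open>x0 > 0\<close> by (simp add: sol[symmetric])
  moreover have "strict_antimono_on {0<..} x"
    using solution_strict_antimono[of x0] \<open>x0 > 0\<close> by (simp add: sol[symmetric])
  ultimately show ?thesis by blast
qed

end
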